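(* Every nonzero vector field in $\mathscr{B}$ has non-zero curl. In particular, on the space of all formal sums $\sum b^l_{i,k}{\rm B}^l_{i,k}$ ($b^l_{i,k}\in\mathbb{R}$, over all integers $i,k\ge0$ and $-1\le l\le 2i+1$), the null space of the curl operator is $\mathbb{R}\,{\rm B}^0_{0,0}$.
   Context: Work over $\mathbb{R}$ with coordinates $(x,y,z)$ and $\Delta:=xz-y^2$. Vector fields (with polynomial or formal power series coefficients) are identified both with derivations and with triples of components; $[v,w]=vw-wv$ and ${\rm ad}_v w=[v,w]$. Let ${\rm N}=x\frac{\partial}{\partial y}+2y\frac{\partial}{\partial z}$, ${\rm M}=z\frac{\partial}{\partial y}+2y\frac{\partial}{\partial x}$, and $\kappa_{l,m}:=\frac{m!}{(m-l)!}$. For integers $i,k\ge 0$, $-1\le l\le 2i+1$, define $${\rm B}^l_{i,k}:=\frac{{\rm ad}_{\rm N}^{\,l+1}(z^i\Delta^k{\rm M})}{\kappa_{l+1,2i+2}}.$$ In particular ${\rm B}^1_{0,0}=-{\rm N}$. The space $\mathscr{B}$ consists of all formal vector fields $c\,{\rm B}^1_{0,0}+\sum b^l_{i,k}{\rm B}^l_{i,k}$ with $c,b^l_{i,k}\in\mathbb R$, the (possibly infinite) sum being over $i,k\ge0$ with $i+2k\ge1$ and $-1\le l\le 2i+1$. The curl is the usual Euclidean curl in $(x,y,z)$. *)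

theory Defs
  imports "HOL-Analysis.Analysis" "HOL-Computational_Algebra.Formal_Power_Series"
begin

text \<open>
  The ring \<open>\<real>[[x,y,z]]\<close> is rendered as the iterated power series ring \<open>\<real>[[x]][[y]][[z]]\<close>:
  the innermost variable is \<open>x\<close>, the outermost one is \<open>z\<close>.
\<close>

type_synonym series3 = "real fps fps fps"

definition scoeff :: "series3 \<Rightarrow> nat \<Rightarrow> nat \<Rightarrow> nat \<Rightarrow> real" where
  \<comment> \<open>coefficient of \<open>x^a * y^b * z^c\<close>\<close>
  "scoeff f a b c = fps_nth (fps_nth (fps_nth f c) b) a"

definition const3 :: "real \<Rightarrow> series3" where
  "const3 r = fps_const (fps_const (fps_const r))"

definition varx :: series3 where "varx = fps_const (fps_const fps_X)"
definition vary :: series3 where "vary = fps_const fps_X"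
definition varz :: series3 where "varz = fps_X"

definition dx :: "series3 \<Rightarrow> series3" where
  "dx f = Abs_fps (\<lambda>c. Abs_fps (\<lambda>b. fps_deriv (fps_nth (fps_nth f c) b)))"

definition dy :: "series3 \<Rightarrow> series3" where
  "dy f = Abs_fps (\<lambda>c. fps_deriv (fps_nth f c))"

definition dz :: "series3 \<Rightarrow> series3" where
  "dz f = fps_deriv f"

text \<open>
  A formal vector field is the triple of its components along
  \<open>\<partial>/\<partial>x\<close>, \<open>\<partial>/\<partial>y\<close>, \<open>\<partial>/\<partial>z\<close>.
\<close>

type_synonym vfield = "series3 ^ 3"

definition vf_app :: "vfield \<Rightarrow> series3 \<Rightarrow> series3" where
  "vf_app v f = v $ 1 * dx f + v $ 2 * dy f + v $ 3 * dz f"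

text \<open>The components of the commutator \<open>v w - w v\<close> of derivations, i.e. its values on the coordinates.\<close>

definition ad :: "vfield \<Rightarrow> vfield \<Rightarrow> vfield" where
  "ad v w = (\<chi> j. vf_app v (w $ j) - vf_app w (v $ j))"

definition curl :: "vfield \<Rightarrow> vfield" where
  "curl v = vector [dy (v $ 3) - dz (v $ 2), dz (v $ 1) - dx (v $ 3), dx (v $ 2) - dy (v $ 1)]"

definition Delta :: series3 where
  "Delta = varx * varz - vary ^ 2"

definition vfN :: vfield where
  "vfN = vector [0, varx, 2 * vary]"

definition vfM :: vfield where
  "vfM = vector [2 * vary, varz, 0]"

definition kappa :: "nat \<Rightarrow> nat \<Rightarrow> real" where
  "kappa l m = fact m / fact (m - l)"

text \<open>Meaningful only for \<open>-1 \<le> l \<le> 2 * int i + 1\<close>.\<close>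

definition vfB :: "int \<Rightarrow> nat \<Rightarrow> nat \<Rightarrow> vfield" where
  "vfB l i k =
     const3 (1 / kappa (nat (l + 1)) (2 * i + 2)) *s
       ((ad vfN ^^ nat (l + 1)) ((varz ^ i * Delta ^ k) *s vfM))"

text \<open>
  \<open>v\<close> is the formal sum of the family \<open>F\<close> over \<open>I\<close>: each coefficient of each component
  receives only finitely many nonzero contributions, and these add up to the one of \<open>v\<close>.
\<close>

definition has_formal_sum :: "('i \<Rightarrow> vfield) \<Rightarrow> 'i set \<Rightarrow> vfield \<Rightarrow> bool" where
  "has_formal_sum F I v \<longleftrightarrow>
     (\<forall>j a b c.
        finite {p \<in> I. scoeff (F p $ j) a b c \<noteq> 0} \<and>
        scoeff (v $ j) a b c = (\<Sum>p | p \<in> I \<and> scoeff (F p $ j) a b c \<noteq> 0. scoeff (F p $ j) a b c))"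

definition Bindex :: "(int \<times> nat \<times> nat) set" where
  "Bindex = {(l, i, k). -1 \<le> l \<and> l \<le> 2 * int i + 1}"

definition Bsums :: "(int \<times> nat \<times> nat) set \<Rightarrow> vfield set" where
  "Bsums I = {v. \<exists>b :: int \<Rightarrow> nat \<Rightarrow> nat \<Rightarrow> real.
                has_formal_sum (\<lambda>(l, i, k). const3 (b l i k) *s vfB l i k) I v}"

definition spaceB :: "vfield set" where
  "spaceB = {const3 c *s vfB 1 0 0 + w | c w.
               w \<in> Bsums {(l, i, k) \<in> Bindex. i + 2 * k \<ge> 1}}"

end

theory Submission
  imports Defs
begin

text \<open>
  Every \<open>B\<close> is divergence free and annihilates \<open>\<Delta>\<close>: this holds for \<open>z\<^sup>i \<Delta>\<^sup>k M\<close>, it is preserved by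
  \<open>ad\<^sub>N\<close> because \<open>N\<close> has both properties, and it passes to formal sums. If such a field \<open>v = (P, Q, R)\<close> is
  also curl free, then \<open>v\<close> is the gradient of a harmonic series killed by
  \<open>L = z \<partial>\<^sub>x - 2 y \<partial>\<^sub>y + x \<partial>\<^sub>z\<close>, the derivation along the gradient of \<open>\<Delta>\<close>. The Laplacian is a sum of
  three operators with distinct weights under \<open>L\<close>, so each of them annihilates the potential; this
  is a system so overdetermined that only the multiples of \<open>(x, 0, -z) = B\<^sup>0\<^sub>0\<^sub>0\<close> remain. An element of
  \<open>\<B>\<close> has linear part proportional to \<open>N\<close>, hence cannot be a nonzero such multiple.
\<close>

section \<open>Coefficients and partial derivatives in three variables\<close>

lemma series3_eqI: "(\<And>a b c. scoeff f a b c = scoeff g a b c) \<Longrightarrow> f = g"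
  by (auto simp: scoeff_def fps_eq_iff)

lemma scoeff_0 [simp]: "scoeff 0 a b c = 0"
  by (simp add: scoeff_def)

lemma scoeff_add [simp]: "scoeff (f + g) a b c = scoeff f a b c + scoeff g a b c"
  by (simp add: scoeff_def)

lemma scoeff_diff [simp]: "scoeff (f - g) a b c = scoeff f a b c - scoeff g a b c"
  by (simp add: scoeff_def)

lemma scoeff_uminus [simp]: "scoeff (- f) a b c = - scoeff f a b c"
  by (simp add: scoeff_def)

lemma scoeff_const3_mult [simp]: "scoeff (const3 r * f) a b c = r * scoeff f a b c"
  by (simp add: scoeff_def const3_def)

lemma scoeff_varx_mult [simp]:
  "scoeff (varx * f) a b c = (if a = 0 then 0 else scoeff f (a - 1) b c)"
  by (simp add: scoeff_def varx_def)

lemma scoeff_vary_mult [simp]: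
  "scoeff (vary * f) a b c = (if b = 0 then 0 else scoeff f a (b - 1) c)"
  by (simp add: scoeff_def vary_def)

lemma scoeff_varz_mult [simp]:
  "scoeff (varz * f) a b c = (if c = 0 then 0 else scoeff f a b (c - 1))"
  by (simp add: scoeff_def varz_def)

lemma scoeff_mult_000: "scoeff (f * g) 0 0 0 = scoeff f 0 0 0 * scoeff g 0 0 0"
  by (simp add: scoeff_def)

lemma scoeff_dx [simp]: "scoeff (dx f) a b c = real (a + 1) * scoeff f (a + 1) b c"
  by (simp add: scoeff_def dx_def)

lemma of_nat_fps_mult_nth: "fps_nth (of_nat n * f) m = of_nat n * fps_nth f m"
  by (induction n) (auto simp: algebra_simps)

lemma scoeff_dy [simp]: "scoeff (dy f) a b c = real (b + 1) * scoeff f a (b + 1) c"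
  by (simp add: scoeff_def dy_def of_nat_fps_mult_nth distrib_right)

lemma scoeff_dz [simp]: "scoeff (dz f) a b c = real (c + 1) * scoeff f a b (c + 1)"
  by (simp add: scoeff_def dz_def of_nat_fps_mult_nth distrib_right)

lemma numeral_eq_const3: "numeral n = const3 (numeral n)"
  by (simp add: const3_def numeral_fps_const)

lemma scoeff_numeral_mult [simp]: "scoeff (numeral n * f) a b c = numeral n * scoeff f a b c"
  by (simp add: numeral_eq_const3)

lemma dx_diff [simp]: "dx (f - g) = dx f - dx g"
  and dy_diff [simp]: "dy (f - g) = dy f - dy g"
  and dz_diff [simp]: "dz (f - g) = dz f - dz g"
  and dx_add [simp]: "dx (f + g) = dx f + dx g"
  and dy_add [simp]: "dy (f + g) = dy f + dy g"
  and dz_add [simp]: "dz (f + g) = dz f + dz g"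
  and dx_uminus [simp]: "dx (- f) = - dx f"
  and dy_uminus [simp]: "dy (- f) = - dy f"
  and dz_uminus [simp]: "dz (- f) = - dz f"
  and dx_0 [simp]: "dx 0 = 0"
  and dy_0 [simp]: "dy 0 = 0"
  and dz_0 [simp]: "dz 0 = 0"
  by (auto intro!: series3_eqI simp: algebra_simps)

lemma dx_mult [simp]: "dx (f * g) = dx f * g + f * dx g"
proof (rule series3_eqI)
  fix a b c
  \<comment> \<open>Coefficients in \<open>x\<close> stay packed: at fixed \<open>b\<close> and
    \<open>c\<close> the claim is the product rule of \<open>fps_deriv\<close>, summed over the
    convolutions in \<open>y\<close> and \<open>z\<close>.\<close>
  have "fps_nth (fps_nth (dx (f * g)) c) b = fps_nth (fps_nth (dx f * g + f * dx g) c) b"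
    by (simp add: dx_def fps_mult_nth fps_deriv_sum sum.distrib flip: fps_sum_nth)
      (simp add: fps_sum_nth fps_mult_nth fps_deriv_sum sum.distrib add.commute)
  then show "scoeff (dx (f * g)) a b c = scoeff (dx f * g + f * dx g) a b c"
    by (simp only: scoeff_def)
qed

lemma dy_mult [simp]: "dy (f * g) = dy f * g + f * dy g"
proof (rule fps_ext)
  fix c
  show "fps_nth (dy (f * g)) c = fps_nth (dy f * g + f * dy g) c"
    by (simp add: dy_def fps_mult_nth fps_deriv_sum sum.distrib add.commute)
qed

lemma dz_mult [simp]: "dz (f * g) = dz f * g + f * dz g"
  by (simp add: dz_def)

lemma dx_const3 [simp]: "dx (const3 r) = 0"
  and dy_const3 [simp]: "dy (const3 r) = 0"
  and dz_const3 [simp]: "dz (const3 r) = 0"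
  by (auto intro!: series3_eqI simp: scoeff_def const3_def dx_def dy_def dz_def)

lemma d_numeral [simp]: "dx (numeral n) = 0" "dy (numeral n) = 0" "dz (numeral n) = 0"
  by (simp_all add: numeral_eq_const3)

lemma d_one [simp]: "dx 1 = 0" "dy 1 = 0" "dz 1 = 0"
  by (auto intro!: fps_ext simp: dx_def dy_def dz_def)

lemma d_vars [simp]:
  "dx varx = 1" "dx vary = 0" "dx varz = 0"
  "dy varx = 0" "dy vary = 1" "dy varz = 0"
  "dz varx = 0" "dz vary = 0" "dz varz = 1"
  by (auto intro!: fps_ext simp: dx_def dy_def dz_def varx_def vary_def varz_def)

lemma dy_dx: "dy (dx f) = dx (dy f)"
  and dz_dx: "dz (dx f) = dx (dz f)"
  and dz_dy: "dz (dy f) = dy (dz f)"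
  by (auto intro!: series3_eqI)

lemma constant_if_gradient_zero:
  assumes "dx g = 0" "dy g = 0" "dz g = 0"
  shows "g = const3 (scoeff g 0 0 0)"
proof (rule series3_eqI)
  fix a b c
  \<comment> \<open>At a zero exponent truncated subtraction makes the equation speak of exponent 1;
    such an equation is true but does not concern the coefficient at \<open>a\<close>,
    \<open>b\<close>, \<open>c\<close>, which is reached through a nonzero exponent.\<close>
  have "scoeff (dx g) (a - 1) b c = 0" "scoeff (dy g) a (b - 1) c = 0" "scoeff (dz g) a b (c - 1) = 0"
    using assms by auto
  then have "scoeff g a b c = 0" if "a \<noteq> 0 \<or> b \<noteq> 0 \<or> c \<noteq> 0"
    using that by (auto split: if_splits)
  then show "scoeff g a b c = scoeff (const3 (scoeff g 0 0 0)) a b c"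
    by (auto simp: scoeff_def const3_def)
qed

section \<open>Divergence-free fields tangent to the level surfaces of \<Delta>\<close>

definition divergence :: "vfield \<Rightarrow> series3" where
  "divergence v = dx (v $ 1) + dy (v $ 2) + dz (v $ 3)"

definition solenoidal_tangent :: "vfield \<Rightarrow> bool" where
  "solenoidal_tangent v \<longleftrightarrow> divergence v = 0 \<and> vf_app v Delta = 0"

lemma vf_app_Delta: "vf_app v Delta = varz * v $ 1 - 2 * (vary * v $ 2) + varx * v $ 3"
  by (simp add: vf_app_def Delta_def power2_eq_square algebra_simps)

lemma vfield_eq_iff: "v = w \<longleftrightarrow> v $ 1 = w $ 1 \<and> v $ 2 = w $ 2 \<and> v $ (3::3) = (w $ 3 :: series3)"
  by (simp add: vec_eq_iff forall_3)

lemma solenoidal_tangent_irrotational: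
  assumes "solenoidal_tangent v" and "curl v = 0"
  shows "\<exists>c. v = vector [const3 c * varx, 0, - (const3 c * varz)]"
proof -
  define P where "P = v $ 1"
  define Q where "Q = v $ 2"
  define R where "R = v $ 3"
  \<comment> \<open>For a potential phi of \<open>v\<close> these are S = phi_xx + phi_zz, T =
    phi_xz and C = phi_yy, so the Laplacian is S + C.\<close>
  define S where "S = dx P + dz R"
  define T where "T = dz P"
  define C where "C = dy Q"
  have div: "dx P + dy Q + dz R = 0" and tan: "varz * P - 2 * (vary * Q) + varx * R = 0"
    using assms(1) by (auto simp: solenoidal_tangent_def divergence_def vf_app_Delta P_def Q_def R_def)
  have curl: "dy R = dz Q" "dx R = dz P" "dx Q = dy P"
    using assms(2) by (auto simp: curl_def vfield_eq_iff P_def Q_def R_def)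
  have tx: "varz * dx P - 2 * (vary * dx Q) + R + varx * dx R = 0"
    using arg_cong[OF tan, of dx] by (simp add: algebra_simps)
  have ty: "varz * dy P - 2 * Q - 2 * (vary * dy Q) + varx * dy R = 0"
    using arg_cong[OF tan, of dy] by (simp add: algebra_simps)
  have tz: "P + varz * dz P - 2 * (vary * dz Q) + varx * dz R = 0"
    using arg_cong[OF tan, of dz] by (simp add: algebra_simps)
  \<comment> \<open>The facts \<open>LC\<close>, \<open>LC'\<close> and \<open>LT\<close> below are the action of \<open>L\<close> on second derivatives of a potential
    of \<open>v\<close>: they give \<open>L C = 4 T = 4 C\<close> and \<open>L T = C\<close>.\<close>
  have S: "S = - C"
    using div by (simp add: S_def C_def algebra_simps eq_neg_iff_add_eq_0)
  \<comment> \<open>oriented as a confluent system of rewrite rules for the partial derivatives\<close>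
  note normal = curl[symmetric] dy_dx dz_dx dz_dy
  have "varz * dx S - 2 * (vary * dy S) + varx * dz S + 4 * T = 0"
  proof -
    have "dx (varz * dx P - 2 * (vary * dx Q) + R + varx * dx R) +
        dz (P + varz * dz P - 2 * (vary * dz Q) + varx * dz R) = 0"
      by (simp only: tx tz dx_0 dz_0 add_0)
    then show ?thesis
      by (simp add: S_def T_def normal algebra_simps)
  qed
  then have LC: "varz * dx C - 2 * (vary * dy C) + varx * dz C = 4 * T"
    by (simp add: S algebra_simps)
  have LC': "varz * dx C - 2 * (vary * dy C) + varx * dz C = 4 * C"
    using arg_cong[OF ty, of dy] by (simp add: C_def normal algebra_simps)
  have LT: "varz * dx T - 2 * (vary * dy T) + varx * dz T = - S"
    using arg_cong[OF tx, of dz] by (simp add: S_def T_def normal algebra_simps)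
  have TC: "T = C"
    using LC LC' by simp
  \<comment> \<open>With \<open>T = C\<close> and \<open>S = - C\<close>, \<open>LT\<close> reads L
    C = C, whereas \<open>LC'\<close> reads L C = 4 C.\<close>
  have "C = 4 * C"
    using LC' LT by (simp add: TC S)
  then have C: "C = 0" by simp
  then have "S = 0" "T = 0" using S TC by simp_all
  then have d0: "dy Q = 0" "dz R = - dx P" "dz P = 0" "dx R = 0"
    using C curl by (simp_all add: S_def T_def C_def eq_neg_iff_add_eq_0 add.commute)
  \<comment> \<open>As phi_xz = 0, also phi_xxx = - phi_xzz = 0. Hence \<open>dx P\<close> is a
    series in \<open>y\<close> alone.\<close>
  have dg: "dx (dx P) = 0" "dz (dx P) = 0"
    using arg_cong[OF d0(2), of dx] arg_cong[OF d0(3), of dx] arg_cong[OF d0(4), of dz]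
    by (auto simp: dz_dx)
  define h where "h = dy (dx P)"
  have R: "R = 2 * (vary * dx Q) - varz * dx P"
    using tx d0 by (simp add: algebra_simps)
  have P: "P = 2 * (vary * dz Q) + varx * dx P"
    using tz d0 by (simp add: algebra_simps)
  \<comment> \<open>Since \<open>dy Q = 0\<close>, neither \<open>dx Q\<close> nor
    \<open>dz Q\<close> depends on \<open>y\<close>. Differentiating the formulas for
    \<open>R\<close> and \<open>P\<close> in \<open>y\<close> thus leaves two linear equations for
    these unknowns in terms of \<open>h\<close>.\<close>
  have Ry: "dz Q = 2 * dx Q - varz * h"
    using arg_cong[OF R, of dy] arg_cong[OF d0(1), of dx]
    by (simp add: normal h_def algebra_simps)
  have Py: "dx Q = 2 * dz Q + varx * h"
    using arg_cong[OF P, of dy] arg_cong[OF d0(1), of dz]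
    by (simp add: curl(3) h_def dy_dx dz_dy algebra_simps)
  have Qx: "3 * dx Q = (2 * varz - varx) * h"
    using Ry Py by algebra
  \<comment> \<open>Neither \<open>h\<close> nor \<open>dx Q\<close> depends on \<open>z\<close>, so
    the \<open>z\<close>-derivative of \<open>Qx\<close> is 0 = 2 h.\<close>
  have "dz h = 0"
    using arg_cong[OF dg(2), of dy] by (simp add: h_def dz_dy)
  moreover have "dz (dx Q) = 0"
    using arg_cong[OF d0(3), of dy] by (simp add: curl dz_dy)
  ultimately have h: "h = 0"
    using arg_cong[OF Qx, of dz] by simp
  have Qx0: "dx Q = 0" using Qx h by simp
  have Qz0: "dz Q = 0" using Ry h Qx0 by simp
  have "2 * Q = 0"
    using ty by (simp add: curl(1) curl(3)[symmetric] d0 Qx0 Qz0)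
  then have Q0: "Q = 0" by simp
  obtain c where c: "dx P = const3 c"
    using constant_if_gradient_zero[of "dx P"] dg h by (auto simp: h_def)
  have "v = vector [const3 c * varx, 0, - (const3 c * varz)]"
    using P R Q0 c Qx0 Qz0 by (simp add: vfield_eq_iff P_def Q_def R_def mult.commute)
  then show ?thesis by blast
qed

section \<open>The fields \<open>vfB\<close> are divergence free and tangent\<close>

lemma vfN_nth [simp]: "vfN $ 1 = 0" "vfN $ 2 = varx" "vfN $ 3 = 2 * vary"
  by (simp_all add: vfN_def)

lemma vfM_nth [simp]: "vfM $ 1 = 2 * vary" "vfM $ 2 = varz" "vfM $ 3 = 0"
  by (simp_all add: vfM_def)

lemma ad_vfN_nth:
  "ad vfN w $ 1 = vf_app vfN (w $ 1)"
  "ad vfN w $ 2 = vf_app vfN (w $ 2) - w $ 1"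
  "ad vfN w $ 3 = vf_app vfN (w $ 3) - 2 * w $ 2"
  by (simp_all add: ad_def vf_app_def)

text \<open>In general div [v,w] = v(div w) - w(div v) and [v,w] \<Delta> = v(w \<Delta>) - w(v
  \<Delta>); for v = N the second terms drop out.\<close>

lemma solenoidal_tangent_ad_vfN:
  assumes "solenoidal_tangent w"
  shows "solenoidal_tangent (ad vfN w)"
proof -
  have "divergence (ad vfN w) = vf_app vfN (divergence w)"
    by (simp add: divergence_def ad_vfN_nth vf_app_def dy_dx dz_dx dz_dy algebra_simps)
  moreover have "vf_app (ad vfN w) Delta = vf_app vfN (vf_app w Delta)"
    unfolding vf_app_Delta ad_vfN_nth by (simp add: vf_app_def algebra_simps)
  moreover have "vf_app vfN 0 = 0"
    by (simp add: vf_app_def)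
  ultimately show ?thesis
    using assms by (simp add: solenoidal_tangent_def)
qed

lemma vf_app_mult: "vf_app v (f * g) = vf_app v f * g + f * vf_app v g"
  by (simp add: vf_app_def algebra_simps)

lemma vf_app_power_eq_0: "vf_app v f = 0 \<Longrightarrow> vf_app v (f ^ n) = 0"
  by (induction n) (simp_all add: vf_app_mult, simp add: vf_app_def)

lemma vf_app_smult: "vf_app (f *s v) g = f * vf_app v g"
  by (simp add: vf_app_def algebra_simps)

lemma divergence_smult: "divergence (f *s v) = vf_app v f + f * divergence v"
  by (simp add: divergence_def vf_app_def algebra_simps)

text \<open>M annihilates both \<open>z\<close> and \<Delta>, so the factor in front of M is a first
  integral, and scaling by a first integral creates no divergence.\<close>

lemma solenoidal_tangent_vfM: "solenoidal_tangent ((varz ^ i * Delta ^ k) *s vfM)"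
proof -
  have "vf_app vfM varz = 0"
    by (simp add: vf_app_def)
  moreover have "vf_app vfM Delta = 0"
    by (simp add: vf_app_Delta algebra_simps)
  ultimately have "vf_app vfM (varz ^ i * Delta ^ k) = 0"
    by (simp add: vf_app_mult vf_app_power_eq_0)
  then show ?thesis
    by (simp add: solenoidal_tangent_def divergence_smult vf_app_smult)
      (simp add: divergence_def vf_app_Delta algebra_simps)
qed

lemma solenoidal_tangent_const3: "solenoidal_tangent v \<Longrightarrow> solenoidal_tangent (const3 c *s v)"
  by (simp add: solenoidal_tangent_def divergence_smult vf_app_smult) (simp add: vf_app_def)

lemma solenoidal_tangent_vfB: "solenoidal_tangent (vfB l i k)"
proof -
  have "solenoidal_tangent ((ad vfN ^^ n) ((varz ^ i * Delta ^ k) *s vfM))" for n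
    by (induction n) (simp_all add: solenoidal_tangent_vfM solenoidal_tangent_ad_vfN)
  then show ?thesis
    by (simp add: vfB_def solenoidal_tangent_const3)
qed

section \<open>Closure under addition and formal sums\<close>

lemma solenoidal_tangent_add:
  "solenoidal_tangent v \<Longrightarrow> solenoidal_tangent w \<Longrightarrow> solenoidal_tangent (v + w)"
proof -
  assume "solenoidal_tangent v" "solenoidal_tangent w"
  moreover have "divergence (v + w) = divergence v + divergence w"
    by (simp add: divergence_def)
  moreover have "vf_app (v + w) Delta = vf_app v Delta + vf_app w Delta"
    by (simp add: vf_app_def algebra_simps)
  ultimately show ?thesis by (simp add: solenoidal_tangent_def)
qed

text \<open>Each coefficient comes with its own finite support. A coefficient of the divergence or
  of \<open>vf_app v Delta\<close> reads only a few coefficients of \<open>v\<close>, and the union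
  of their supports is one finite sum valid for all of them, so linearity applies.\<close>

lemma has_formal_sum_finite:
  assumes "has_formal_sum F I v" and "finite J"
  obtains K where "finite K" "K \<subseteq> I"
    "\<And>j a b c. (j, a, b, c) \<in> J \<Longrightarrow> scoeff (v $ j) a b c = (\<Sum>p\<in>K. scoeff (F p $ j) a b c)"
proof
  let ?K = "\<Union>(j, a, b, c)\<in>J. {p \<in> I. scoeff (F p $ j) a b c \<noteq> 0}"
  show fin: "finite ?K"
    using assms by (auto simp: has_formal_sum_def)
  show "?K \<subseteq> I" by auto
  fix j a b c
  assume "(j, a, b, c) \<in> J"
  then show "scoeff (v $ j) a b c = (\<Sum>p\<in>?K. scoeff (F p $ j) a b c)"
    using assms(1) unfolding has_formal_sum_def
    by (auto intro!: sum.mono_neutral_left fin)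
qed

lemma solenoidal_tangent_has_formal_sum:
  assumes "has_formal_sum F I v" and st: "\<And>p. p \<in> I \<Longrightarrow> solenoidal_tangent (F p)"
  shows "solenoidal_tangent v"
proof -
  have "scoeff (divergence v) a b c = 0" for a b c
  proof -
    let ?J = "{(1, a + 1, b, c), (2, a, b + 1, c), (3, a, b, c + 1)} :: (3 \<times> nat \<times> nat \<times> nat) set"
    obtain K where K: "finite K" "K \<subseteq> I"
      "\<And>j a b c. (j, a, b, c) \<in> ?J \<Longrightarrow> scoeff (v $ j) a b c = (\<Sum>p\<in>K. scoeff (F p $ j) a b c)"
      by (rule has_formal_sum_finite[OF assms(1), of ?J]) auto
    have "scoeff (divergence v) a b c = (\<Sum>p\<in>K. scoeff (divergence (F p)) a b c)"
      using K(3) by (simp add: divergence_def sum.distrib sum_distrib_left)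
    also have "\<dots> = 0"
      using K(2) st by (intro sum.neutral) (auto simp: solenoidal_tangent_def)
    finally show ?thesis .
  qed
  moreover have "scoeff (vf_app v Delta) a b c = 0" for a b c
  proof -
    \<comment> \<open>At a zero exponent the truncated index is spurious but harmless: the
      corresponding product with a variable has coefficient 0 on both sides.\<close>
    let ?J = "{(1, a, b, c - 1), (2, a, b - 1, c), (3, a - 1, b, c)} :: (3 \<times> nat \<times> nat \<times> nat) set"
    obtain K where K: "finite K" "K \<subseteq> I"
      "\<And>j a b c. (j, a, b, c) \<in> ?J \<Longrightarrow> scoeff (v $ j) a b c = (\<Sum>p\<in>K. scoeff (F p $ j) a b c)"
      by (rule has_formal_sum_finite[OF assms(1), of ?J]) auto
    have "scoeff (vf_app v Delta) a b c = (\<Sum>p\<in>K. scoeff (vf_app (F p) Delta) a b c)"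
      using K(3) by (simp add: vf_app_Delta sum.distrib sum_subtractf sum_distrib_left)
    also have "\<dots> = 0"
      using K(2) st by (intro sum.neutral) (auto simp: solenoidal_tangent_def)
    finally show ?thesis .
  qed
  ultimately show ?thesis
    by (auto simp: solenoidal_tangent_def intro!: series3_eqI)
qed

lemma solenoidal_tangent_Bsums: "v \<in> Bsums I \<Longrightarrow> solenoidal_tangent v"
  unfolding Bsums_def
  by (auto elim!: solenoidal_tangent_has_formal_sum
      intro: solenoidal_tangent_const3 solenoidal_tangent_vfB)

section \<open>Fields with components in the square of the ideal (x, y, z)\<close>

definition no_linear_part :: "series3 \<Rightarrow> bool" where
  "no_linear_part f \<longleftrightarrow> (\<forall>a b c. a + b + c \<le> 1 \<longrightarrow> scoeff f a b c = 0)"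

text \<open>The coefficients of N are linear forms, so the bracket with N preserves polynomial
  degree.\<close>

lemma no_linear_part_ad_vfN:
  assumes "\<forall>j. no_linear_part (w $ j)"
  shows "\<forall>j. no_linear_part (ad vfN w $ j)"
proof -
  have "no_linear_part (vf_app vfN f)" if "no_linear_part f" for f
    using that by (auto simp: no_linear_part_def vf_app_def mult.assoc)
  then show ?thesis
    using assms by (simp add: forall_3 ad_vfN_nth) (simp add: no_linear_part_def)
qed

text \<open>The assumption makes \<open>z\<close> or \<Delta> occur as a factor; both vanish at the
  origin, and the components of M contribute a further degree.\<close>

lemma no_linear_part_vfM:
  assumes "i + 2 * k \<ge> 1"
  shows "\<forall>j. no_linear_part (((varz ^ i * Delta ^ k) *s vfM) $ j)"
proof -
  let ?g = "varz ^ i * Delta ^ k"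
  have z: "scoeff varz 0 0 0 = 0" and D: "scoeff Delta 0 0 0 = 0"
    using scoeff_varz_mult[of 1] scoeff_varx_mult[of varz] scoeff_vary_mult[of vary]
    by (simp_all add: Delta_def power2_eq_square)
  have "scoeff (f ^ n) 0 0 0 = 0" if "scoeff f 0 0 0 = 0" "n > 0" for f n
    using that by (cases n) (simp_all add: scoeff_mult_000)
  then have g0: "scoeff ?g 0 0 0 = 0"
    using assms z D by (cases "i = 0") (auto simp: scoeff_mult_000)
  have "no_linear_part (vary * ?g)" "no_linear_part (varz * ?g)"
    unfolding no_linear_part_def
  proof safe
    fix a b c :: nat
    assume "a + b + c \<le> 1"
    then have "b \<noteq> 0 \<Longrightarrow> a = 0 \<and> b - 1 = 0 \<and> c = 0" "c \<noteq> 0 \<Longrightarrow> a = 0 \<and> b = 0 \<and> c - 1 = 0"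
      by auto
    then show "scoeff (vary * ?g) a b c = 0" "scoeff (varz * ?g) a b c = 0"
      using g0 by auto
  qed
  moreover have "?g * (2 * vary) = 2 * (vary * ?g)" "?g * varz = varz * ?g"
    by (simp_all add: algebra_simps)
  ultimately show ?thesis
    by (simp only: forall_3 vector_smult_component vfM_nth) (simp add: no_linear_part_def)
qed

lemma no_linear_part_vfB:
  assumes "i + 2 * k \<ge> 1"
  shows "no_linear_part (vfB l i k $ j)"
proof -
  have "\<forall>j. no_linear_part ((ad vfN ^^ n) ((varz ^ i * Delta ^ k) *s vfM) $ j)" for n
  proof (induction n)
    case 0
    then show ?case using no_linear_part_vfM[OF assms] by simp
  next
    case (Suc n)
    then show ?case using no_linear_part_ad_vfN by simp
  qed
  then show ?thesis
    by (simp add: vfB_def no_linear_part_def)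
qed

lemma no_linear_part_Bsums:
  assumes "w \<in> Bsums {(l, i, k) \<in> Bindex. i + 2 * k \<ge> 1}"
  shows "no_linear_part (w $ j)"
proof -
  have "scoeff (w $ j) a b c = 0" if "a + b + c \<le> 1" for a b c
  proof -
    obtain r where "has_formal_sum (\<lambda>(l, i, k). const3 (r l i k) *s vfB l i k)
        {(l, i, k) \<in> Bindex. i + 2 * k \<ge> 1} w"
      using assms by (auto simp: Bsums_def)
    moreover have "scoeff ((const3 (r l i k) *s vfB l i k) $ j) a b c = 0" if "i + 2 * k \<ge> 1" for l i k
      using no_linear_part_vfB[OF that] \<open>a + b + c \<le> 1\<close> by (simp add: no_linear_part_def)
    ultimately show ?thesis
      unfolding has_formal_sum_def by (auto intro!: sum.neutral)
  qed
  then show ?thesis by (simp add: no_linear_part_def)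
qed

section \<open>The linear fields and the null space of the curl\<close>

lemma const3_mult: "const3 a * const3 b = const3 (a * b)"
  by (simp add: const3_def)

text \<open>The bracket [N,M] is 2 (x, 0, -z), and \<kappa> at (1, 2) equals 2. The result is the
  gradient of (x^2 - z^2)/2, the solution found for irrotational fields.\<close>

lemma vfB_000: "vfB 0 0 0 = vector [varx, 0, - varz]"
proof -
  have "const3 (1 / 2) * (2 * f) = f" for f
    by (intro series3_eqI) simp
  then show ?thesis
    by (simp add: vfB_def vfield_eq_iff ad_vfN_nth kappa_def fact_numeral)
      (simp add: vf_app_def)
qed

lemma vfB_100: "vfB 1 0 0 = - vfN"
proof -
  \<comment> \<open>Two brackets give (0, -2x, -4y), to be divided by \<kappa> at (2, 2), which is
    again 2.\<close>
  have "const3 (1 / 2) * 4 = 2" "const3 (1 / 2) * 2 = 1"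
    by (simp_all add: numeral_eq_const3 const3_mult) (simp add: const3_def)
  then show ?thesis
    by (simp add: vfB_def vfield_eq_iff numeral_2_eq_2 ad_vfN_nth kappa_def fact_numeral)
      (simp add: vf_app_def)
qed

lemma vfB_000_in_Bsums: "const3 c *s vfB 0 0 0 \<in> Bsums Bindex"
proof -
  let ?b = "\<lambda>(l::int) (i::nat) (k::nat). if l = 0 \<and> i = 0 \<and> k = 0 then c else 0"
  let ?F = "\<lambda>(l, i, k). const3 (?b l i k) *s vfB l i k"
  have "has_formal_sum ?F Bindex (const3 c *s vfB 0 0 0)"
    unfolding has_formal_sum_def
  proof (intro allI)
    fix j x y z
    let ?A = "{p \<in> Bindex. scoeff (?F p $ j) x y z \<noteq> 0}"
    have sub: "?A \<subseteq> {(0, 0, 0)}"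
      by (auto split: if_splits)
    then have "(\<Sum>p\<in>?A. scoeff (?F p $ j) x y z) = (\<Sum>p\<in>{(0, 0, 0)}. scoeff (?F p $ j) x y z)"
      by (intro sum.mono_neutral_left) (auto simp: Bindex_def)
    then show "finite ?A \<and> scoeff ((const3 c *s vfB 0 0 0) $ j) x y z = (\<Sum>p\<in>?A. scoeff (?F p $ j) x y z)"
      using finite_subset[OF sub] by simp
  qed
  then show ?thesis
    unfolding Bsums_def mem_Collect_eq by (rule exI[of _ ?b])
qed

lemma curl_vfB_000: "curl (const3 c *s vfB 0 0 0) = 0"
  by (simp add: curl_def vfield_eq_iff vfB_000)

theorem theorem4p10:
  shows "(\<forall>v \<in> spaceB. v \<noteq> 0 \<longrightarrow> curl v \<noteq> 0) \<and>
         {v \<in> Bsums Bindex. curl v = 0} = {const3 c *s vfB 0 0 0 | c. True}"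
proof (intro conjI ballI impI notI)
  fix v
  assume "v \<in> spaceB" "v \<noteq> 0" "curl v = 0"
  then obtain c w where v: "v = const3 c *s vfB 1 0 0 + w"
    and w: "w \<in> Bsums {(l, i, k) \<in> Bindex. i + 2 * k \<ge> 1}"
    by (auto simp: spaceB_def)
  have "solenoidal_tangent v"
    unfolding v by (intro solenoidal_tangent_add solenoidal_tangent_const3 solenoidal_tangent_vfB
        solenoidal_tangent_Bsums[OF w])
  then obtain r where r: "v = vector [const3 r * varx, 0, - (const3 r * varz)]"
    using solenoidal_tangent_irrotational \<open>curl v = 0\<close> by blast
  \<comment> \<open>The coefficient of \<open>x\<close> in the first component detects
    \<open>r\<close>: it vanishes for N and for \<open>w\<close>, but equals \<open>r\<close> in the
    form of \<open>v\<close> just obtained.\<close>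
  have "scoeff (w $ 1) 1 0 0 = 0"
    using no_linear_part_Bsums[OF w] by (simp add: no_linear_part_def)
  then have "scoeff (v $ 1) 1 0 0 = 0"
    by (simp add: v vfB_100)
  moreover have "scoeff varx 1 0 0 = 1"
    by (simp add: scoeff_def varx_def)
  ultimately have "r = 0" by (simp add: r)
  then show False
    using \<open>v \<noteq> 0\<close> r by (simp add: vfield_eq_iff const3_def)
next
  show "{v \<in> Bsums Bindex. curl v = 0} = {const3 c *s vfB 0 0 0 | c. True}"
  proof (intro equalityI subsetI)
    fix v
    assume "v \<in> {v \<in> Bsums Bindex. curl v = 0}"
    then obtain r where "v = vector [const3 r * varx, 0, - (const3 r * varz)]"
      using solenoidal_tangent_irrotational solenoidal_tangent_Bsums by blast
    then have "v = const3 r *s vfB 0 0 0"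
      by (simp add: vfield_eq_iff vfB_000)
    then show "v \<in> {const3 c *s vfB 0 0 0 | c. True}" by blast
  qed (auto simp: vfB_000_in_Bsums curl_vfB_000)
qed

end
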